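(* Let $G_1$ be an $r_1$-regular graph with $n_1$ vertices and $G_2$ an $r_2$-regular graph with $n_2$ vertices. Then the Laplacian spectrum (with multiplicities) of $G_1\underset{=}{\vee}G_2$ consists of: - $n_1+\mu_j(G_2)$ for each $j=2,3,\dots,n_2$; - the two roots of the equation $$x^2+(2r_1-2n_1-n_2-\mu_i(G_1)+2)x+n_1^2-2r_1n_1-2n_1+n_1n_2-r_1n_2-n_2+\mu_i(G_1)\big(n_1+r_1+1-\mu_i(G_1)\big)=0$$ for each $i=2,3,\dots,n_1$; - the three roots of the equation $$x^3+(2r_1-3n_1-n_2+2)x^2+(n_1n_2-n_2r_1-n_2+2n_1^2-2r_1n_1-2n_1)x=0.$$
   Context: Graphs are finite, undirected and simple. With $A(G)$ the adjacency matrix and $D(G)$ the diagonal degree matrix, $L(G)=D(G)-A(G)$ is the Laplacian; $0=\mu_1(G)\le\mu_2(G)\le\dots\le\mu_n(G)$ denote its eigenvalues, and the Laplacian spectrum is the multiset of these eigenvalues. For vertex-disjoint graphs $G_1$ (with $V(G_1)=\{u_1,\dots,u_{n_1}\}$) and $G_2$, the join $G_1\vee G_2$ is the disjoint union together with all edges between $V(G_1)$ and $V(G_2)$. The NNS (Non Neighbors Splitting) join $G_1\underset{=}{\vee}G_2$ is obtained from $G_1\vee G_2$ by adding new vertices $u_1',\dots,u_{n_1}'$ and joining $u_i'$ to $u_j$ if and only if $i\ne j$ and $u_iu_j\notin E(G_1)$. *)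

theory Defs
  imports
    "Graph_Theory.Pair_Digraph"
    "Jordan_Normal_Form.Char_Poly"
begin

text \<open>
  A finite simple undirected graph is a \<^locale>\<open>pair_graph\<close>: an edge between \<open>u\<close> and \<open>v\<close> is
  represented by the two arcs \<open>(u, v)\<close> and \<open>(v, u)\<close>.  The degree of a vertex in the undirected
  sense is hence its \<^const>\<open>out_degree\<close>.
\<close>

definition regular_graph :: "nat \<Rightarrow> 'a pair_pre_digraph \<Rightarrow> bool" where
  "regular_graph r G \<longleftrightarrow> pair_graph G \<and> (\<forall>v\<in>pverts G. out_degree (with_proj G) v = r)"

definition graph_join ::
  "'a pair_pre_digraph \<Rightarrow> 'b pair_pre_digraph \<Rightarrow> ('a + 'b) pair_pre_digraph" where
  "graph_join G H = \<lparr>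
     pverts = Inl ` pverts G \<union> Inr ` pverts H,
     parcs = {(Inl u, Inl v) | u v. (u, v) \<in> parcs G}
           \<union> {(Inr u, Inr v) | u v. (u, v) \<in> parcs H}
           \<union> {(Inl u, Inr v) | u v. u \<in> pverts G \<and> v \<in> pverts H}
           \<union> {(Inr v, Inl u) | u v. u \<in> pverts G \<and> v \<in> pverts H} \<rparr>"

text \<open>The vertices of the join are tagged \<^const>\<open>Inl\<close>; the new vertex \<open>u'\<close> is \<open>Inr u\<close>.\<close>

definition nns_join ::
  "'a pair_pre_digraph \<Rightarrow> 'b pair_pre_digraph \<Rightarrow> (('a + 'b) + 'a) pair_pre_digraph" where
  "nns_join G H = \<lparr>
     pverts = Inl ` pverts (graph_join G H) \<union> Inr ` pverts G,
     parcs = {(Inl x, Inl y) | x y. (x, y) \<in> parcs (graph_join G H)}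
           \<union> {(Inr u, Inl (Inl v)) | u v.
                u \<in> pverts G \<and> v \<in> pverts G \<and> u \<noteq> v \<and> (u, v) \<notin> parcs G}
           \<union> {(Inl (Inl v), Inr u) | u v.
                u \<in> pverts G \<and> v \<in> pverts G \<and> u \<noteq> v \<and> (u, v) \<notin> parcs G} \<rparr>"

text \<open>Matrices of a graph with respect to an enumeration \<open>vs\<close> of its vertices.\<close>

definition vertex_enum :: "'a pair_pre_digraph \<Rightarrow> 'a list \<Rightarrow> bool" where
  "vertex_enum G vs \<longleftrightarrow> distinct vs \<and> set vs = pverts G"

definition adjacency_matrix :: "'a list \<Rightarrow> 'a pair_pre_digraph \<Rightarrow> real mat" where
  "adjacency_matrix vs G =
     mat (length vs) (length vs) (\<lambda>(i, j). if (vs ! i, vs ! j) \<in> parcs G then 1 else 0)"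

definition degree_matrix :: "'a list \<Rightarrow> 'a pair_pre_digraph \<Rightarrow> real mat" where
  "degree_matrix vs G =
     mat (length vs) (length vs)
       (\<lambda>(i, j). if i = j then real (out_degree (with_proj G) (vs ! i)) else 0)"

definition laplacian_matrix :: "'a list \<Rightarrow> 'a pair_pre_digraph \<Rightarrow> real mat" where
  "laplacian_matrix vs G = degree_matrix vs G - adjacency_matrix vs G"

text \<open>
  The multiset of eigenvalues, with algebraic multiplicity.  The choice of the enumeration is
  immaterial (\<open>laplacian_spectrum_eq\<close>), and since the Laplacian is symmetric, no eigenvalue is
  lost by working over the reals (\<open>size_laplacian_spectrum\<close>).
\<close>

definition laplacian_spectrum :: "'a pair_pre_digraph \<Rightarrow> real multiset" where
  "laplacian_spectrum G = proots (char_poly (laplacian_matrix (SOME vs. vertex_enum G vs) G))"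

text \<open>The \<open>j\<close>-th smallest Laplacian eigenvalue, for \<open>1 \<le> j \<le> card (pverts G)\<close>.\<close>

definition laplacian_eigenvalue :: "'a pair_pre_digraph \<Rightarrow> nat \<Rightarrow> real" where
  "laplacian_eigenvalue G j = sorted_list_of_multiset (laplacian_spectrum G) ! (j - 1)"


lemma pair_graph_nns_join:
  assumes "pair_graph G" "pair_graph H"
  shows "pair_graph (nns_join G H)"
proof -
  interpret G: pair_graph G by fact
  interpret H: pair_graph H by fact
  have symG: "(v, u) \<in> parcs G" if "(u, v) \<in> parcs G" for u v
    using that G.pair_sym_arcs by (auto simp: symmetric_def elim: symE)
  have symH: "(v, u) \<in> parcs H" if "(u, v) \<in> parcs H" for u v
    using that H.pair_sym_arcs by (auto simp: symmetric_def elim: symE)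
  have nlG: "(u, u) \<notin> parcs G" for u using G.pair_no_loops by fastforce
  have nlH: "(u, u) \<notin> parcs H" for u using H.pair_no_loops by fastforce
  have fin: "finite (pverts (nns_join G H))"
    using G.pair_finite_verts H.pair_finite_verts by (simp add: nns_join_def graph_join_def)
  have sub: "parcs (nns_join G H) \<subseteq> pverts (nns_join G H) \<times> pverts (nns_join G H)"
    using G.in_arcsD1 G.in_arcsD2 H.in_arcsD1 H.in_arcsD2
    by (auto simp: nns_join_def graph_join_def)
  show ?thesis
  proof
    show "finite (parcs (nns_join G H))"
      using fin sub by (meson finite_SigmaI finite_subset)
    show "symmetric (with_proj (nns_join G H))"
      using symG symH
      by (auto simp: symmetric_def nns_join_def graph_join_def intro!: symI)
    show "fst e \<noteq> snd e" if "e \<in> parcs (nns_join G H)" for e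
      using that nlG nlH by (auto simp: nns_join_def graph_join_def)
  qed (use fin sub in auto)
qed

lemma laplacian_matrix_dim [simp]:
  "dim_row (laplacian_matrix vs G) = length vs"
  "dim_col (laplacian_matrix vs G) = length vs"
  by (simp_all add: laplacian_matrix_def degree_matrix_def adjacency_matrix_def)

lemma laplacian_matrix_carrier [simp]:
  "laplacian_matrix vs G \<in> carrier_mat (length vs) (length vs)"
  by (rule carrier_matI) simp_all

lemma laplacian_matrix_index:
  assumes "i < length vs" "j < length vs"
  shows "laplacian_matrix vs G $$ (i, j) =
    (if i = j then real (out_degree (with_proj G) (vs ! i)) else 0)
    - (if (vs ! i, vs ! j) \<in> parcs G then 1 else 0)"
  using assms by (simp add: laplacian_matrix_def degree_matrix_def adjacency_matrix_def)

lemma det_permute_both: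
  fixes A :: "'a :: comm_ring_1 mat"
  assumes A: "A \<in> carrier_mat n n" and p: "p permutes {0..<n}"
  shows "det (mat n n (\<lambda>(i, j). A $$ (p i, p j))) = det A"
proof -
  have lt: "p i < n" if "i < n" for i using permutes_in_image[OF p, of i] that by auto
  define B where "B = mat n n (\<lambda>(i, j). A $$ (i, p j))"
  have B: "B \<in> carrier_mat n n" by (simp add: B_def)
  have "det B = det (transpose_mat B)" using det_transpose[OF B] by simp
  also have "transpose_mat B = mat n n (\<lambda>(i, j). transpose_mat A $$ (p i, j))"
    using A lt by (intro eq_matI) (auto simp: B_def)
  also have "det \<dots> = signof p * det A"
    using det_permute_rows[of "transpose_mat A" n p] A p det_transpose[OF A] by simp
  finally have 1: "det B = signof p * det A" .
  have "mat n n (\<lambda>(i, j). A $$ (p i, p j)) = mat n n (\<lambda>(i, j). B $$ (p i, j))"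
    using lt by (intro eq_matI) (auto simp: B_def)
  also have "det \<dots> = signof p * det B" by (rule det_permute_rows[OF B p])
  also have "\<dots> = det A" unfolding 1 by (simp add: sign_def)
  finally show ?thesis .
qed

lemma char_poly_laplacian_eq:
  assumes vs: "vertex_enum G vs" and ws: "vertex_enum G ws"
  shows "char_poly (laplacian_matrix vs G) = char_poly (laplacian_matrix ws G)"
proof -
  let ?n = "length vs"
  have "mset vs = mset ws"
    using vs ws by (auto simp: vertex_enum_def set_eq_iff_mset_eq_distinct[symmetric])
  then obtain p where p: "p permutes {..<length vs}" and perm: "permute_list p vs = ws"
    using mset_eq_permutation by metis
  have p': "p permutes {0..<?n}" using p by (simp add: atLeast0LessThan)
  have len: "length ws = ?n" using perm by auto
  have nth: "ws ! i = vs ! p i" if "i < ?n" for i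
    using permute_list_nth[OF p that] perm by simp
  have lt: "p i < ?n" if "i < ?n" for i using permutes_in_image[OF p', of i] that by auto
  have inj: "p i = p j \<longleftrightarrow> i = j" for i j using permutes_inj[OF p'] by (auto dest: injD)
  have "char_poly_matrix (laplacian_matrix ws G) =
    mat ?n ?n (\<lambda>(i, j). char_poly_matrix (laplacian_matrix vs G) $$ (p i, p j))"
  proof (rule eq_matI)
    fix i j
    assume "i < dim_row (mat ?n ?n (\<lambda>(i, j). char_poly_matrix (laplacian_matrix vs G) $$ (p i, p j)))"
      and "j < dim_col (mat ?n ?n (\<lambda>(i, j). char_poly_matrix (laplacian_matrix vs G) $$ (p i, p j)))"
    then have ij: "i < ?n" "j < ?n" by auto
    show "char_poly_matrix (laplacian_matrix ws G) $$ (i, j) =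
      mat ?n ?n (\<lambda>(i, j). char_poly_matrix (laplacian_matrix vs G) $$ (p i, p j)) $$ (i, j)"
      using ij lt[OF ij(1)] lt[OF ij(2)] len inj[of i j]
      by (simp add: char_poly_matrix_def laplacian_matrix_index nth)
  qed (use len in \<open>simp_all add: char_poly_matrix_def\<close>)
  then show ?thesis
    unfolding char_poly_def
    using det_permute_both[OF char_poly_matrix_closed[OF laplacian_matrix_carrier[of vs G]] p']
    by simp
qed

lemma ex_vertex_enum: "finite (pverts G) \<Longrightarrow> \<exists>vs. vertex_enum G vs"
  unfolding vertex_enum_def using finite_distinct_list by metis

lemma laplacian_spectrum_eq:
  assumes vs: "vertex_enum G vs"
  shows "laplacian_spectrum G = proots (char_poly (laplacian_matrix vs G))"
proof -
  have "vertex_enum G (SOME vs. vertex_enum G vs)" using vs by (rule someI)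
  then show ?thesis using char_poly_laplacian_eq[OF _ vs] by (simp add: laplacian_spectrum_def)
qed

lemma symmetric_eigenvalue_real:
  fixes A :: "real mat"
  assumes A: "A \<in> carrier_mat n n" and sym: "transpose_mat A = A"
    and ev: "eigenvalue (map_mat complex_of_real A) k"
  shows "k \<in> \<real>"
proof -
  let ?A = "map_mat complex_of_real A"
  from ev A obtain v where v: "v \<in> carrier_vec n" "v \<noteq> 0\<^sub>v n" and Av: "?A *\<^sub>v v = k \<cdot>\<^sub>v v"
    unfolding eigenvalue_def eigenvector_def by auto
  have row: "(\<Sum>j<n. complex_of_real (A $$ (i, j)) * v $ j) = k * v $ i" if "i < n" for i
  proof -
    have "(?A *\<^sub>v v) $ i = (\<Sum>j<n. complex_of_real (A $$ (i, j)) * v $ j)"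
      using that A v by (auto simp: scalar_prod_def atLeast0LessThan intro!: sum.cong)
    then show ?thesis using Av that v by simp
  qed
  have symA: "A $$ (i, j) = A $$ (j, i)" if "i < n" "j < n" for i j
    using sym A that by (metis carrier_matD index_transpose_mat(1))
  define N where "N = (\<Sum>i<n. cnj (v $ i) * v $ i)"
  define S where "S = (\<Sum>i<n. \<Sum>j<n. cnj (v $ i) * complex_of_real (A $$ (i, j)) * v $ j)"
  have "S = (\<Sum>i<n. cnj (v $ i) * (k * v $ i))"
    unfolding S_def by (intro sum.cong refl) (simp add: row[symmetric] sum_distrib_left mult.assoc)
  then have S: "S = k * N" by (simp add: N_def sum_distrib_left mult_ac)
  have "cnj S = (\<Sum>i<n. \<Sum>j<n. v $ i * complex_of_real (A $$ (i, j)) * cnj (v $ j))"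
    by (simp add: S_def)
  also have "\<dots> = (\<Sum>j<n. \<Sum>i<n. v $ i * complex_of_real (A $$ (i, j)) * cnj (v $ j))"
    by (rule sum.swap)
  also have "\<dots> = S"
    unfolding S_def by (intro sum.cong refl) (simp add: symA mult_ac)
  finally have cS: "cnj S = S" .
  have N: "N = complex_of_real (\<Sum>i<n. (cmod (v $ i))\<^sup>2)"
    by (simp add: N_def complex_norm_square mult.commute del: of_real_power flip: of_real_power)
  obtain i where i: "i < n" "v $ i \<noteq> 0" using v by (metis carrier_vecD eq_vecI index_zero_vec)
  have "(\<Sum>i<n. (cmod (v $ i))\<^sup>2) > 0"
    by (rule sum_pos2[of _ i]) (use i in auto)
  then have "N \<noteq> 0" unfolding N by (metis less_irrefl of_real_eq_0_iff)
  moreover have "cnj N = N" by (simp add: N)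
  ultimately have "cnj k = k" using S cS by (metis complex_cnj_mult mult_right_cancel)
  then show ?thesis by (simp add: Reals_cnj_iff)
qed

lemma size_laplacian_spectrum:
  assumes "pair_graph G"
  shows "size (laplacian_spectrum G) = card (pverts G)"
proof -
  interpret pair_graph G by fact
  obtain vs where vs: "vertex_enum G vs" using ex_vertex_enum pair_finite_verts by blast
  interpret R: map_poly_inj_idom_hom complex_of_real ..
  let ?L = "laplacian_matrix vs G" and ?n = "length vs"
  let ?C = "map_mat complex_of_real ?L"
  have L: "?L \<in> carrier_mat ?n ?n" by simp
  have C: "?C \<in> carrier_mat ?n ?n" by simp
  have symarc: "(v, u) \<in> parcs G" if "(u, v) \<in> parcs G" for u v
    using that pair_sym_arcs by (auto simp: symmetric_def elim: symE)
  have "transpose_mat ?L = ?L"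
  proof (rule eq_matI)
    fix i j assume "i < dim_row ?L" "j < dim_col ?L"
    then have ij: "i < ?n" "j < ?n" by simp_all
    show "transpose_mat ?L $$ (i, j) = ?L $$ (i, j)"
      using ij L symarc[of "vs ! i" "vs ! j"] symarc[of "vs ! j" "vs ! i"]
      by (auto simp: laplacian_matrix_index)
  qed (use L in auto)
  note real = symmetric_eigenvalue_real[OF L this]
  obtain as where as: "char_poly ?C = (\<Prod>a\<leftarrow>as. [:- a, 1:])" and len: "length as = ?n"
    using char_poly_factorized[OF C] by blast
  have "a \<in> \<real>" if "a \<in> set as" for a
  proof (rule real)
    have "poly (char_poly ?C) a = 0"
      using that unfolding as by (simp add: poly_prod_list prod_list_zero_iff image_iff o_def)
    then show "eigenvalue ?C a" using eigenvalue_root_char_poly[OF C] by simp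
  qed
  then have as_Re: "map complex_of_real (map Re as) = as"
    by (induction as) auto
  have "map_poly complex_of_real (char_poly ?L) = char_poly ?C"
    using of_real_hom.char_poly_hom[OF L, where 'a = complex] by simp
  also have "\<dots> = (\<Prod>a\<leftarrow>map complex_of_real (map Re as). [:- a, 1:])"
    unfolding as as_Re ..
  also have "\<dots> = map_poly complex_of_real (\<Prod>a\<leftarrow>map Re as. [:- a, 1:])"
    unfolding R.hom_prod_list by (simp add: o_def)
  finally have "char_poly ?L = (\<Prod>a\<leftarrow>map Re as. [:- a, 1:])"
    by (simp only: R.eq_iff)
  moreover have "size (proots (\<Prod>a\<leftarrow>bs. [:- a, 1:])) = length bs" for bs :: "real list"
  proof (induction bs)
    case (Cons b bs)
    have "(\<Prod>a\<leftarrow>bs. [:- a, 1:]) \<noteq> 0"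
      by (simp only: prod_list_zero_iff) auto
    then show ?case using Cons proots_mult[of "[:- b, 1:]" "\<Prod>a\<leftarrow>bs. [:- a, 1:]"]
      by (simp del: mult_pCons_left)
  qed simp
  ultimately have "size (proots (char_poly ?L)) = ?n" using len by (metis length_map)
  moreover have "?n = card (pverts G)"
    using vs by (metis distinct_card vertex_enum_def)
  ultimately show ?thesis using laplacian_spectrum_eq[OF vs] by simp
qed

end

theory Submission imports Defs
begin

text \<open>
  Order the vertices of the NNS join as \<open>u\<^sub>i\<close>, \<open>u\<^sub>i'\<close>, \<open>V(G\<^sub>2)\<close>.  With
  \<open>s = r\<^sub>1 + 1\<close>, every block of \<open>x I - L\<close> is a polynomial in \<open>L(G\<^sub>1)\<close>, \<open>L(G\<^sub>2)\<close> or an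
  all-ones matrix \<open>J\<close>.  Since \<open>J\<close> is annihilated by the Laplacians, two Schur complements reduce
  \<open>det (x I - L)\<close> to \<open>det ((x - n\<^sub>1) I - L(G\<^sub>2)) * det (q(L(G\<^sub>1)) - c J)\<close> with \<open>q\<close> quadratic and
  \<open>c\<close> a scalar; the rank-one term only changes the factor \<open>q(0)\<close> that belongs to the eigenvalue \<open>0\<close>
  of \<open>L(G\<^sub>1)\<close>, and this factor together with the factor \<open>x - n\<^sub>1\<close> from the eigenvalue \<open>0\<close> of
  \<open>L(G\<^sub>2)\<close> becomes the cubic.  The divisions by \<open>x - n\<^sub>1\<close> and \<open>q(0)\<close> exclude only finitely many \<open>x\<close>.
\<close>

section \<open>Determinants of block matrices\<close>

text \<open>Multiplying from the right by a block triangular matrix of determinant 1 clears the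
  lower left block. With that block written as \<open>D * X\<close>, the factor \<open>X\<close>
  takes the place of the inverse of \<open>D\<close> times the block.\<close>

lemma det_four_block_mat_Schur_lower:
  fixes A :: "'a :: idom mat"
  assumes A: "A \<in> carrier_mat n n" and B: "B \<in> carrier_mat n m"
    and D: "D \<in> carrier_mat m m" and X: "X \<in> carrier_mat m n"
  shows "det (four_block_mat A B (D * X) D) = det (A - B * X) * det D"
proof -
  let ?M = "four_block_mat A B (D * X) D"
  let ?N = "four_block_mat (1\<^sub>m n) (0\<^sub>m n m) (- X) (1\<^sub>m m)"
  have M: "?M \<in> carrier_mat (n + m) (n + m)" and N: "?N \<in> carrier_mat (n + m) (n + m)"
    using A D X by auto
  have DX: "D * X \<in> carrier_mat m n" using D X by auto
  have "det ?M * det ?N = det (?M * ?N)"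
    using det_mult[OF M N] ..
  also have "?M * ?N = four_block_mat (A - B * X) B (0\<^sub>m m n) D"
    by (subst mult_four_block_mat[OF A B DX D one_carrier_mat zero_carrier_mat uminus_carrier_mat[OF X] one_carrier_mat])
       (use A B D X DX in \<open>auto intro!: cong_four_block_mat simp: minus_add_uminus_mat[symmetric]\<close>)
  also have "det \<dots> = det (A - B * X) * det D"
    by (rule det_four_block_mat_lower_left_zero[of _ n _ m]) (use A B D X in auto)
  also have "det ?N = 1"
    by (subst det_four_block_mat_upper_right_zero[of _ n _ m]) (use X in auto)
  finally show ?thesis by simp
qed

text \<open>The mirror image, clearing the upper right block. Comparing both eliminations of one
  bordered matrix yields the rank-one determinant formula below.\<close>

lemma det_four_block_mat_Schur_upper:
  fixes A :: "'a :: idom mat"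
  assumes A: "A \<in> carrier_mat n n" and C: "C \<in> carrier_mat m n"
    and D: "D \<in> carrier_mat m m" and X: "X \<in> carrier_mat n m"
  shows "det (four_block_mat A (A * X) C D) = det A * det (D - C * X)"
proof -
  let ?M = "four_block_mat A (A * X) C D"
  let ?N = "four_block_mat (1\<^sub>m n) (- X) (0\<^sub>m m n) (1\<^sub>m m)"
  have M: "?M \<in> carrier_mat (n + m) (n + m)" and N: "?N \<in> carrier_mat (n + m) (n + m)"
    using A D X by auto
  have AX: "A * X \<in> carrier_mat n m" using A X by auto
  have CX: "C * X \<in> carrier_mat m m" using C X by auto
  have "det ?M * det ?N = det (?M * ?N)"
    using det_mult[OF M N] ..
  also have "?M * ?N = four_block_mat A (0\<^sub>m n m) C (D - C * X)"
  proof -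
    have "- (A * X) + A * X = 0\<^sub>m n m" "- (C * X) + D = D - C * X"
      using A C D X by (auto intro!: eq_matI simp del: index_mult_mat(1))
    then show ?thesis
      by (subst mult_four_block_mat[OF A AX C D one_carrier_mat uminus_carrier_mat[OF X]
            zero_carrier_mat one_carrier_mat], intro cong_four_block_mat)
         (use A C D X AX CX in simp_all)
  qed
  also have "det \<dots> = det A * det (D - C * X)"
    by (rule det_four_block_mat_upper_right_zero[OF A refl C minus_carrier_mat[OF CX]])
  also have "det ?N = 1"
    using det_four_block_mat_lower_left_zero[OF one_carrier_mat uminus_carrier_mat[OF X] refl one_carrier_mat] by simp
  finally show ?thesis by simp
qed

section \<open>Constant matrices and rank-one updates\<close>

definition const_mat :: "nat \<Rightarrow> nat \<Rightarrow> 'a \<Rightarrow> 'a mat" where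
  "const_mat n m c = mat n m (\<lambda>_. c)"

lemma const_mat_carrier [simp]: "const_mat n m c \<in> carrier_mat n m"
  and const_mat_dim [simp]: "dim_row (const_mat n m c) = n" "dim_col (const_mat n m c) = m"
  and const_mat_index [simp]: "i < n \<Longrightarrow> j < m \<Longrightarrow> const_mat n m c $$ (i, j) = c"
  by (auto simp: const_mat_def)

lemma const_mat_mult:
  "const_mat n m a * const_mat m k (b :: 'a :: semiring_1) = const_mat n k (of_nat m * (a * b))"
  by (rule eq_matI) (auto simp: scalar_prod_def)

text \<open>Each column of the right factor is a constant vector, which \<open>A\<close> scales by
  its common row sum. The constant may vary with the column, to cover a block that vanishes on the
  columns of the u_i'.\<close>

lemma mult_mat_const_cols:
  fixes A :: "'a :: semiring_1 mat"
  assumes A: "A \<in> carrier_mat n m" and sum: "\<And>i. i < n \<Longrightarrow> (\<Sum>j<m. A $$ (i, j)) = b"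
  shows "A * mat m k (\<lambda>(i, j). f j) = mat n k (\<lambda>(i, j). b * f j)"
  using A sum
  by (intro eq_matI) (auto simp: scalar_prod_def atLeast0LessThan sum_distrib_right[symmetric])

lemma mult_const_mat:
  fixes A :: "'a :: semiring_1 mat"
  assumes "A \<in> carrier_mat n m" and "\<And>i. i < n \<Longrightarrow> (\<Sum>j<m. A $$ (i, j)) = b"
  shows "A * const_mat m k c = const_mat n k (b * c)"
  using mult_mat_const_cols[OF assms, of k "\<lambda>_. c"] by (simp add: const_mat_def case_prod_beta')

lemma const_mat_mult_left:
  fixes A :: "'a :: semiring_1 mat"
  assumes A: "A \<in> carrier_mat n m" and sum: "\<And>j. j < m \<Longrightarrow> (\<Sum>i<n. A $$ (i, j)) = b"
  shows "const_mat k n c * A = const_mat k m (c * b)"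
  using A sum
  by (intro eq_matI) (auto simp: scalar_prod_def atLeast0LessThan sum_distrib_left[symmetric])

text \<open>Both Schur complements of the matrix \<open>A\<close> bordered by constant vectors.\<close>

lemma det_add_const_mat:
  fixes A :: "'a :: field mat"
  assumes A: "A \<in> carrier_mat n n" and AJ: "A * const_mat n 1 1 = const_mat n 1 b"
    and b: "b \<noteq> 0"
  shows "det (A + const_mat n n c) = det A * (1 + c * of_nat n / b)"
proof -
  let ?R = "const_mat 1 n (1 :: 'a)"
  \<comment> \<open>The all-ones vector is an eigenvector of \<open>A\<close> for \<open>b\<close>,
    so dividing by \<open>b\<close> solves the linear system that the upper Schur complement asks
    for.\<close>
  have c1: "A * const_mat n 1 (- c / b) = const_mat n 1 (- c)"
  proof -
    have "const_mat n 1 (- c / b) = (- c / b) \<cdot>\<^sub>m const_mat n 1 1"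
      by (rule eq_matI) auto
    then have "A * const_mat n 1 (- c / b) = (- c / b) \<cdot>\<^sub>m const_mat n 1 b"
      using A AJ mult_smult_distrib[OF A const_mat_carrier[of n 1 1]] by metis
    then show ?thesis
      using b by (auto intro!: eq_matI)
  qed
  \<comment> \<open>Adding \<open>c\<close> J is subtracting the outer product of the constant
    column \<open>- c\<close> and the all-ones row, that is, the Schur complement of the border
    entry 1.\<close>
  have "det (A + const_mat n n c) = det (A - const_mat n 1 (- c) * ?R) * det (1\<^sub>m 1)"
    using A by (auto simp: const_mat_mult intro!: arg_cong[of _ _ det] eq_matI)
  also have "\<dots> = det (four_block_mat A (const_mat n 1 (- c)) ?R (1\<^sub>m 1))"
    using det_four_block_mat_Schur_lower[OF A const_mat_carrier one_carrier_mat const_mat_carrier,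
        of 1 "- c" "1 :: 'a"] left_mult_one_mat[OF const_mat_carrier, of 1 n "1 :: 'a"]
    by metis
  also have "\<dots> = det A * det (1\<^sub>m 1 - ?R * const_mat n 1 (- c / b))"
    using det_four_block_mat_Schur_upper[OF A const_mat_carrier[of 1 n 1] one_carrier_mat
        const_mat_carrier[of n 1 "- c / b"]] c1 by metis
  also have "det (1\<^sub>m 1 - ?R * const_mat n 1 (- c / b)) = 1 + c * of_nat n / b"
    by (subst det_single) (auto simp: const_mat_mult intro: minus_carrier_mat)
  finally show ?thesis .
qed

section \<open>Determinants of quadratic polynomials in a matrix\<close>

lemma poly_char_poly:
  fixes A :: "'a :: field mat"
  assumes A: "A \<in> carrier_mat n n"
  shows "poly (char_poly A) k = det (k \<cdot>\<^sub>m 1\<^sub>m n - A)"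
  unfolding char_poly_matrix[OF A]
  by (rule arg_cong[of _ _ det], rule eq_matI) (use A in \<open>auto simp: char_matrix_def\<close>)

lemma complex_monic_quadratic_factor:
  obtains u v :: complex where "u + v = b" "u * v = c"
proof -
  let ?d = "csqrt (b\<^sup>2 - 4 * c)"
  have "(b + ?d) / 2 + (b - ?d) / 2 = b" by (simp add: field_simps)
  moreover have "(b + ?d) / 2 * ((b - ?d) / 2) = (b\<^sup>2 - ?d\<^sup>2) / 4"
    by (simp add: field_simps power2_eq_square)
  then have "(b + ?d) / 2 * ((b - ?d) / 2) = c" by (simp add: field_simps)
  ultimately show ?thesis by (rule that)
qed

text \<open>Over the complex numbers the quadratic splits, so the matrix is the product of u I - A
  and v I - A; both determinants are values of the characteristic polynomial.\<close>

lemma det_monic_quadratic_in_mat: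
  fixes A :: "complex mat"
  assumes A: "A \<in> carrier_mat n n" and S: "char_poly A = (\<Prod>a\<in>#S. [:- a, 1:])"
  shows "det (c \<cdot>\<^sub>m 1\<^sub>m n + b \<cdot>\<^sub>m A + A * A) = (\<Prod>a\<in>#S. c + b * a + a\<^sup>2)"
proof -
  obtain u v where uv: "u + v = - b" "u * v = c"
    by (rule complex_monic_quadratic_factor)
  have b: "b = - u - v" using uv(1) by (simp add: algebra_simps eq_neg_iff_add_eq_0)
  have pS: "poly (char_poly A) k = (\<Prod>a\<in>#S. k - a)" for k
    unfolding S by (simp add: poly_prod_mset image_mset.compositionality o_def)
  let ?U = "u \<cdot>\<^sub>m 1\<^sub>m n - A" and ?V = "v \<cdot>\<^sub>m 1\<^sub>m n - A"
  have UV: "?U \<in> carrier_mat n n" "?V \<in> carrier_mat n n" using A by auto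
  have AA: "A * A \<in> carrier_mat n n" using A by auto
  have "?U * ?V = (u \<cdot>\<^sub>m 1\<^sub>m n) * ?V - A * ?V"
    using A UV(2) by (subst minus_mult_distrib_mat[of _ n n]) auto
  also have "(u \<cdot>\<^sub>m 1\<^sub>m n) * ?V = u \<cdot>\<^sub>m ?V"
    using UV(2) by (subst mult_smult_assoc_mat[of _ n n _ n]) auto
  also have "A * ?V = A * (v \<cdot>\<^sub>m 1\<^sub>m n) - A * A"
    using A by (subst mult_minus_distrib_mat[of _ n n]) auto
  also have "A * (v \<cdot>\<^sub>m 1\<^sub>m n) = v \<cdot>\<^sub>m A"
    using A by (subst mult_smult_distrib[of _ n n _ n]) auto
  also have "u \<cdot>\<^sub>m ?V - (v \<cdot>\<^sub>m A - A * A) = c \<cdot>\<^sub>m 1\<^sub>m n + b \<cdot>\<^sub>m A + A * A"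
    unfolding uv(2)[symmetric] b
    by (intro eq_matI) (use A AA in \<open>auto simp: algebra_simps simp del: index_mult_mat(1)\<close>)
  finally have "det (c \<cdot>\<^sub>m 1\<^sub>m n + b \<cdot>\<^sub>m A + A * A) = det ?U * det ?V"
    using det_mult[OF UV] by simp
  also have "\<dots> = (\<Prod>a\<in>#S. (u - a) * (v - a))"
    by (simp add: poly_char_poly[OF A, symmetric] pS prod_mset.distrib)
  also have "\<dots> = (\<Prod>a\<in>#S. c + b * a + a\<^sup>2)"
    unfolding uv(2)[symmetric] b by (simp add: algebra_simps power2_eq_square)
  finally show ?thesis .
qed

lemma size_char_poly_roots:
  fixes A :: "'a :: idom mat"
  assumes A: "A \<in> carrier_mat n n" and S: "char_poly A = (\<Prod>a\<in>#S. [:- a, 1:])"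
  shows "size S = n"
proof -
  obtain as where as: "mset as = S" using ex_mset by blast
  have "char_poly A = (\<Prod>a\<leftarrow>as. [:- a, 1:])"
    unfolding S as[symmetric] by (simp add: prod_mset_prod_list flip: mset_map)
  then have "degree (char_poly A) = length as"
    using degree_linear_factors[of uminus as] by simp
  then show ?thesis
    using degree_monic_char_poly[OF A] as by auto
qed

text \<open>Negation reduces to the monic case. The sign (-1)^n from the n rows is spread over the
  factors of the product, of which there are \<open>size S\<close> = n.\<close>

lemma det_quadratic_in_mat:
  fixes A :: "complex mat"
  assumes A: "A \<in> carrier_mat n n" and S: "char_poly A = (\<Prod>a\<in>#S. [:- a, 1:])"
  shows "det (c \<cdot>\<^sub>m 1\<^sub>m n + b \<cdot>\<^sub>m A - A * A) = (\<Prod>a\<in>#S. c + b * a - a\<^sup>2)"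
proof -
  let ?M = "(- c) \<cdot>\<^sub>m 1\<^sub>m n + (- b) \<cdot>\<^sub>m A + A * A"
  have "det (c \<cdot>\<^sub>m 1\<^sub>m n + b \<cdot>\<^sub>m A - A * A) = det ((- 1) \<cdot>\<^sub>m ?M)"
    by (rule arg_cong[of _ _ det], rule eq_matI) (use A in \<open>auto simp del: index_mult_mat(1)\<close>)
  also have "\<dots> = (- 1) ^ size S * (\<Prod>a\<in>#S. - c + - b * a + a\<^sup>2)"
    using det_smult[of "- 1" ?M] A
    by (simp add: det_monic_quadratic_in_mat[OF A S] size_char_poly_roots[OF A S])
  also have "\<dots> = (\<Prod>a\<in>#S. c + b * a - a\<^sup>2)"
    by (induction S) (auto simp: algebra_simps)
  finally show ?thesis .
qed

text \<open>For s = r1 + 1, \<open>K\<close> is J - I - A(G1), the adjacency matrix of the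
  complement of G1, and \<open>d\<close> is x minus the degree of a u_i'. The scalar
  \<open>\<beta>\<close> is the value of the quadratic at the eigenvalue 0 of \<open>L1\<close>; the
  last factor on the right is the rank-one correction at that eigenvalue.\<close>

lemma det_nns_join_blocks:
  fixes L1 L2 :: "complex mat" and x s :: complex and n1 n2 :: nat
  defines "K \<equiv> const_mat n1 n1 1 + (L1 - s \<cdot>\<^sub>m 1\<^sub>m n1)"
    and "y \<equiv> x - of_nat n1" and "d \<equiv> x - of_nat n1 + s"
  defines "\<beta> \<equiv> d * (x - of_nat n1 - of_nat n2 + s) - s\<^sup>2"
  assumes L1: "L1 \<in> carrier_mat n1 n1" and S1: "char_poly L1 = (\<Prod>a\<in>#S1. [:- a, 1:])"
    and row1: "\<And>i. i < n1 \<Longrightarrow> (\<Sum>j<n1. L1 $$ (i, j)) = 0"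
    and col1: "\<And>j. j < n1 \<Longrightarrow> (\<Sum>i<n1. L1 $$ (i, j)) = 0"
    and L2: "L2 \<in> carrier_mat n2 n2" and S2: "char_poly L2 = (\<Prod>a\<in>#S2. [:- a, 1:])"
    and row2: "\<And>i. i < n2 \<Longrightarrow> (\<Sum>j<n2. L2 $$ (i, j)) = 0"
    and y: "y \<noteq> 0" and \<beta>: "\<beta> \<noteq> 0"
  shows "det (four_block_mat
      (four_block_mat ((x - of_nat n1 - of_nat n2 + s) \<cdot>\<^sub>m 1\<^sub>m n1 - L1) K K (d \<cdot>\<^sub>m 1\<^sub>m n1))
      (mat (n1 + n1) n2 (\<lambda>(i, j). if i < n1 then 1 else 0))
      (mat n2 (n1 + n1) (\<lambda>(i, j). if j < n1 then 1 else 0))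
      (y \<cdot>\<^sub>m 1\<^sub>m n2 - L2))
    = (\<Prod>a\<in>#S2. y - a) * (\<Prod>a\<in>#S1. \<beta> + (2 * s - d) * a - a\<^sup>2)
      * (1 - (d * of_nat n2 / y + of_nat n1 - 2 * s) * of_nat n1 / \<beta>)"
    (is "det (four_block_mat (four_block_mat ?P K K ?D) ?B ?C ?D2) = _")
proof -
  \<comment> \<open>The rows of \<open>?D2\<close> sum to \<open>y\<close> because those of
    \<open>L2\<close> sum to 0. Hence \<open>?D2 * X = ?C\<close> is solved by \<open>1 / y\<close>
    on columns of ones and by 0 on columns of zeros.\<close>
  define X where "X = mat n2 (n1 + n1) (\<lambda>(i, j). if j < n1 then 1 / y else 0)"
  define J where "J = const_mat n1 n1 (1 :: complex)"
  \<comment> \<open>An entry of the nonzero block of \<open>?B * X\<close>: a sum of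
    \<open>n2\<close> terms \<open>1 / y\<close>.\<close>
  define \<kappa> where "\<kappa> = of_nat n2 / y"
  have P: "?P \<in> carrier_mat n1 n1" and K: "K \<in> carrier_mat n1 n1" and D: "?D \<in> carrier_mat n1 n1"
    and D2: "?D2 \<in> carrier_mat n2 n2" and X: "X \<in> carrier_mat n2 (n1 + n1)"
    and B: "?B \<in> carrier_mat (n1 + n1) n2"
    using L1 L2 by (auto simp: K_def X_def)
  have "?D2 * X = ?C"
  proof -
    have "?D2 * X = mat n2 (n1 + n1) (\<lambda>(i, j). y * (if j < n1 then 1 / y else 0))"
      unfolding X_def
      by (rule mult_mat_const_cols[OF D2]) (use L2 row2 in \<open>auto simp: sum_subtractf simp flip: sum_distrib_left\<close>)
    also have "\<dots> = ?C"
      using y by (intro eq_matI) auto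
    finally show ?thesis .
  qed
  then have "det (four_block_mat (four_block_mat ?P K K ?D) ?B ?C ?D2)
    = det (four_block_mat ?P K K ?D - ?B * X) * det ?D2"
    using det_four_block_mat_Schur_lower[OF four_block_carrier_mat[OF P D] B D2 X, of K K] by simp
  also have "det ?D2 = (\<Prod>a\<in>#S2. y - a)"
    unfolding poly_char_poly[OF L2, symmetric] S2
    by (simp add: poly_prod_mset image_mset.compositionality o_def)
  also have "four_block_mat ?P K K ?D - ?B * X = four_block_mat (?P - const_mat n1 n1 \<kappa>) K K ?D"
    using L1 K
    by (intro eq_matI) (auto simp: X_def \<kappa>_def scalar_prod_def)
  \<comment> \<open>The block \<open>?D\<close> is scalar and so commutes with \<open>K\<close>; the
    determinant of the four blocks is then that of
    \<open>(?P - const_mat n1 n1 \<kappa>) * ?D - K * K\<close>.\<close>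
  also have "det \<dots> = det ((?P - const_mat n1 n1 \<kappa>) * ?D - K * K)"
    by (rule det_four_block_mat)
       (use P K in \<open>auto simp: mult_smult_distrib[of _ n1 n1 _ n1] mult_smult_assoc_mat[of _ n1 n1 _ n1]\<close>)
  also have "(?P - const_mat n1 n1 \<kappa>) * ?D - K * K =
    (\<beta> \<cdot>\<^sub>m 1\<^sub>m n1 + (2 * s - d) \<cdot>\<^sub>m L1 - L1 * L1) + const_mat n1 n1 (- (d * \<kappa> + of_nat n1 - 2 * s))"
  proof -
    let ?T = "L1 - s \<cdot>\<^sub>m 1\<^sub>m n1"
    have T: "?T \<in> carrier_mat n1 n1" using L1 by auto
    have LL: "L1 * L1 \<in> carrier_mat n1 n1" using L1 by auto
    have J: "J \<in> carrier_mat n1 n1" by (simp add: J_def)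
    \<comment> \<open>Row and column sums of \<open>L1\<close> vanish, so J annihilates
      \<open>L1\<close> on both sides. All terms of \<open>K * K\<close> with a factor J add up to
      n1 - 2 s times J.\<close>
    have "K * K = (J * J + ?T * J) + (J * ?T + ?T * ?T)"
      using T J unfolding K_def J_def[symmetric]
      by (simp add: mult_add_distrib_mat[of _ n1 n1 _ n1] add_mult_distrib_mat[of _ n1 n1 _ _ n1])
    also have "J * J = const_mat n1 n1 (of_nat n1)"
      by (simp add: J_def const_mat_mult)
    also have "?T * J = const_mat n1 n1 (- s)"
      using mult_const_mat[OF T, of "- s" n1 1] L1 row1 by (auto simp: J_def sum_subtractf simp flip: sum_distrib_left)
    also have "J * ?T = const_mat n1 n1 (- s)"
      using const_mat_mult_left[OF T, of "- s" n1 1] L1 col1 by (auto simp: J_def sum_subtractf simp flip: sum_distrib_left)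
    also have "?T * ?T = L1 * ?T - s \<cdot>\<^sub>m ?T"
      using L1 T by (subst minus_mult_distrib_mat[of _ n1 n1])
        (auto simp: mult_smult_assoc_mat[of _ n1 n1 _ n1])
    also have "L1 * ?T = L1 * L1 - s \<cdot>\<^sub>m L1"
      using L1 T by (subst mult_minus_distrib_mat[of _ n1 n1])
        (auto simp: mult_smult_distrib[of _ n1 n1 _ n1])
    finally have KK: "K * K = const_mat n1 n1 (of_nat n1) + const_mat n1 n1 (- s)
      + (const_mat n1 n1 (- s) + (L1 * L1 - s \<cdot>\<^sub>m L1 - s \<cdot>\<^sub>m ?T))" .
    have PD: "(?P - const_mat n1 n1 \<kappa>) * ?D = d \<cdot>\<^sub>m (?P - const_mat n1 n1 \<kappa>)"
      using P by (subst mult_smult_distrib[of _ n1 n1 _ n1]) (auto intro!: right_mult_one_mat[of _ n1 n1])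
    show ?thesis
      unfolding KK PD \<beta>_def
      by (intro eq_matI)
         (use L1 LL in \<open>auto simp: algebra_simps power2_eq_square simp del: index_mult_mat(1)\<close>)
  qed
  \<comment> \<open>Since \<open>L1\<close> kills the all-ones vector, the quadratic in
    \<open>L1\<close> maps it to \<open>\<beta>\<close> times itself, which makes
    \<open>\<beta>\<close> the divisor in the rank-one formula.\<close>
  also have "det \<dots> = det (\<beta> \<cdot>\<^sub>m 1\<^sub>m n1 + (2 * s - d) \<cdot>\<^sub>m L1 - L1 * L1)
      * (1 + - (d * \<kappa> + of_nat n1 - 2 * s) * of_nat n1 / \<beta>)"
  proof (rule det_add_const_mat[OF _ _ \<beta>])
    let ?o = "const_mat n1 1 (1 :: complex)"
    have o: "?o \<in> carrier_mat n1 1" by simp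
    have Lo: "L1 * const_mat n1 1 c = const_mat n1 1 0" for c
      using mult_const_mat[OF L1 row1, of 1 c] by simp
    have "(\<beta> \<cdot>\<^sub>m 1\<^sub>m n1 + (2 * s - d) \<cdot>\<^sub>m L1 - L1 * L1) * ?o
      = \<beta> \<cdot>\<^sub>m (1\<^sub>m n1 * ?o) + (2 * s - d) \<cdot>\<^sub>m (L1 * ?o) - (L1 * L1) * ?o"
      using L1 by (subst minus_mult_distrib_mat[of _ n1 n1], (auto)[3], subst add_mult_distrib_mat[of _ n1 n1],
         (auto)[3], subst (1 2) mult_smult_assoc_mat[of _ n1 n1]) auto
    also have "(L1 * L1) * ?o = const_mat n1 1 0"
      by (simp only: assoc_mult_mat[OF L1 L1 o] Lo)
    finally show "(\<beta> \<cdot>\<^sub>m 1\<^sub>m n1 + (2 * s - d) \<cdot>\<^sub>m L1 - L1 * L1) * ?o = const_mat n1 1 \<beta>"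
      unfolding Lo left_mult_one_mat[OF o] by (intro eq_matI) auto
  qed (use L1 in auto)
  also have "det (\<beta> \<cdot>\<^sub>m 1\<^sub>m n1 + (2 * s - d) \<cdot>\<^sub>m L1 - L1 * L1) = (\<Prod>a\<in>#S1. \<beta> + (2 * s - d) * a - a\<^sup>2)"
    by (rule det_quadratic_in_mat[OF L1 S1])
  also have "1 + - (d * \<kappa> + of_nat n1 - 2 * s) * of_nat n1 / \<beta>
      = 1 - (d * of_nat n2 / y + of_nat n1 - 2 * s) * of_nat n1 / \<beta>"
    by (simp add: \<kappa>_def diff_divide_distrib add_divide_distrib algebra_simps)
  finally show ?thesis
    by (simp only: mult_ac)
qed

section \<open>Laplacian spectra\<close>

text \<open>The induction removes one root with its full order. The degree and the number of roots
  drop equally, so the hypothesis passes to the cofactor; once no root is left, the polynomial is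
  constant.\<close>

lemma poly_eq_prod_proots:
  fixes p :: "'a :: idom poly"
  assumes "size (proots p) = degree p"
  shows "p = Polynomial.smult (lead_coeff p) (\<Prod>a\<in>#proots p. [:- a, 1:])"
  using assms
proof (induction p rule: poly_root_order_induct)
  case (no_roots p)
  then have "proots p = {#}"
    by (simp add: multiset_eqI order_root)
  then show ?case
    using no_roots.prems by (auto elim!: degree_eq_zeroE)
next
  case (root p x n)
  have p: "p \<noteq> 0" using root.hyps by auto
  have roots: "proots ([:- x, 1:] ^ n * p) = repeat_mset n {#x#} + proots p"
    using p by (simp add: proots_mult proots_power)
  then have "size (proots p) = degree p"
    using root.prems p by (simp add: degree_mult_eq degree_power_eq)
  then have IH: "Polynomial.smult (lead_coeff p) (\<Prod>a\<in>#proots p. [:- a, 1:]) = p"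
    by (rule root.IH[symmetric])
  have "(\<Prod>a\<in>#repeat_mset n {#x#}. [:- a, 1:]) = [:- x, 1:] ^ n"
    by simp
  then have "Polynomial.smult (lead_coeff ([:- x, 1:] ^ n * p)) (\<Prod>a\<in>#proots ([:- x, 1:] ^ n * p). [:- a, 1:])
    = [:- x, 1:] ^ n * Polynomial.smult (lead_coeff p) (\<Prod>a\<in>#proots p. [:- a, 1:])"
    unfolding roots by (simp add: lead_coeff_mult lead_coeff_power)
  then show ?case unfolding IH by simp
qed simp

lemma proots_prod_linear_factors:
  "proots (\<Prod>a\<in>#S. [:- a, 1:]) = (S :: 'a :: idom multiset)"
proof (induction S)
  case (add a S)
  have "(\<Prod>a\<in>#S. [:- a, 1:]) \<noteq> 0" by (auto simp: prod_mset_zero_iff)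
  then show ?case using add by (simp add: proots_mult del: mult_pCons_left)
qed simp

lemma map_poly_of_real_prod_linear_factors:
  "map_poly complex_of_real (\<Prod>a\<in>#S. [:- a, 1:]) = (\<Prod>a\<in>#image_mset of_real S. [:- a, 1:])"
proof -
  interpret R: map_poly_inj_idom_hom complex_of_real ..
  show ?thesis
    by (induction S) (simp_all add: R.hom_mult del: mult_pCons_left)
qed

section \<open>Row sums and the characteristic polynomial of the Laplacian\<close>

lemma out_degree_with_proj: "out_degree (with_proj G) v = card {w. (v, w) \<in> parcs G}"
proof -
  have "out_arcs (with_proj G) v = Pair v ` {w. (v, w) \<in> parcs G}"
    by (auto simp: out_arcs_def)
  then show ?thesis
    by (simp add: out_degree_def card_image inj_on_def)
qed

lemma sum_nth_enum:
  assumes "vertex_enum G vs"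
  shows "(\<Sum>j<length vs. f (vs ! j)) = (\<Sum>v\<in>pverts G. f v)"
proof -
  have "bij_betw ((!) vs) {..<length vs} (pverts G)"
    using assms by (intro bij_betw_nth) (auto simp: vertex_enum_def)
  then show ?thesis by (rule sum.reindex_bij_betw)
qed

lemma laplacian_row_sum:
  assumes G: "pair_graph G" and vs: "vertex_enum G vs" and i: "i < length vs"
  shows "(\<Sum>j<length vs. laplacian_matrix vs G $$ (i, j)) = 0"
proof -
  interpret pair_graph G by fact
  have "(\<Sum>j<length vs. if (vs ! i, vs ! j) \<in> parcs G then 1 else 0 :: real)
    = (\<Sum>w\<in>pverts G. if (vs ! i, w) \<in> parcs G then 1 else 0)"
    by (rule sum_nth_enum[OF vs])
  also have "\<dots> = real (card {w \<in> pverts G. (vs ! i, w) \<in> parcs G})"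
    by (simp add: sum.If_cases Collect_conj_eq)
  \<comment> \<open>Every arc ends in an enumerated vertex, so the row sees the whole
    degree.\<close>
  also have "{w \<in> pverts G. (vs ! i, w) \<in> parcs G} = {w. (vs ! i, w) \<in> parcs G}"
    using in_arcsD2 by blast
  finally show ?thesis
    using i by (simp add: laplacian_matrix_index out_degree_with_proj sum_subtractf)
qed

lemma laplacian_symmetric:
  assumes "pair_graph G" "i < length vs" "j < length vs"
  shows "laplacian_matrix vs G $$ (i, j) = laplacian_matrix vs G $$ (j, i)"
proof -
  interpret pair_graph G by fact
  show ?thesis using assms(2,3) arcs_symmetric by (auto simp: laplacian_matrix_index)
qed

lemma laplacian_col_sum:
  assumes "pair_graph G" "vertex_enum G vs" "j < length vs"
  shows "(\<Sum>i<length vs. laplacian_matrix vs G $$ (i, j)) = 0"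
  using laplacian_row_sum[OF assms] laplacian_symmetric[OF assms(1) _ assms(3)] by simp

lemma length_vertex_enum: "vertex_enum G vs \<Longrightarrow> length vs = card (pverts G)"
  by (metis distinct_card vertex_enum_def)

text \<open>All eigenvalues of the symmetric Laplacian are real, so there are as many real roots as
  the degree, and the leading coefficient is 1.\<close>

lemma char_poly_laplacian:
  assumes G: "pair_graph G" and vs: "vertex_enum G vs"
  shows "char_poly (laplacian_matrix vs G) = (\<Prod>a\<in>#laplacian_spectrum G. [:- a, 1:])"
proof -
  have monic: "degree (char_poly (laplacian_matrix vs G)) = length vs"
    "lead_coeff (char_poly (laplacian_matrix vs G)) = 1"
    using degree_monic_char_poly[OF laplacian_matrix_carrier, of vs G] by auto
  have "size (proots (char_poly (laplacian_matrix vs G))) = length vs"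
    using size_laplacian_spectrum[OF G] length_vertex_enum[OF vs] laplacian_spectrum_eq[OF vs] by simp
  then show ?thesis
    using poly_eq_prod_proots[of "char_poly (laplacian_matrix vs G)"] monic
    by (simp add: laplacian_spectrum_eq[OF vs])
qed

text \<open>The transfer to complex matrices, where the quadratics in the Laplacian of G1 can be
  factored.\<close>

lemma char_poly_complex_laplacian:
  assumes "pair_graph G" and "vertex_enum G vs"
  shows "char_poly (map_mat complex_of_real (laplacian_matrix vs G))
    = (\<Prod>a\<in>#image_mset of_real (laplacian_spectrum G). [:- a, 1:])"
  using char_poly_laplacian[OF assms] map_poly_of_real_prod_linear_factors
    of_real_hom.char_poly_hom[OF laplacian_matrix_carrier, where 'a = complex]
  by metis

section \<open>The smallest Laplacian eigenvalue\<close>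

lemma laplacian_eigenvalue_iff:
  assumes "vertex_enum G vs"
  shows "a \<in># laplacian_spectrum G \<longleftrightarrow> eigenvalue (laplacian_matrix vs G) a"
proof -
  have "char_poly (laplacian_matrix vs G) \<noteq> 0"
    using degree_monic_char_poly[OF laplacian_matrix_carrier, of vs G] by auto
  then show ?thesis
    by (simp add: laplacian_spectrum_eq[OF assms] eigenvalue_root_char_poly[OF laplacian_matrix_carrier])
qed

text \<open>Gershgorin's argument: look at an entry of largest modulus of an eigenvector.\<close>

lemma eigenvalue_nonneg:
  fixes A :: "real mat"
  assumes A: "A \<in> carrier_mat n n"
    and row: "\<And>i. i < n \<Longrightarrow> (\<Sum>j<n. A $$ (i, j)) = 0"
    and off: "\<And>i j. i < n \<Longrightarrow> j < n \<Longrightarrow> i \<noteq> j \<Longrightarrow> A $$ (i, j) \<le> 0"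
    and ev: "eigenvalue A a"
  shows "0 \<le> a"
proof -
  from ev A obtain v where v: "v \<in> carrier_vec n" "v \<noteq> 0\<^sub>v n" and Av: "A *\<^sub>v v = a \<cdot>\<^sub>v v"
    unfolding eigenvalue_def eigenvector_def by auto
  obtain k where k: "k < n" "v $ k \<noteq> 0" using v by (metis carrier_vecD eq_vecI index_zero_vec)
  obtain i where i: "i < n" and max: "\<And>j. j < n \<Longrightarrow> \<bar>v $ j\<bar> \<le> \<bar>v $ i\<bar>"
  proof -
    have "Max ((\<lambda>j. \<bar>v $ j\<bar>) ` {..<n}) \<in> (\<lambda>j. \<bar>v $ j\<bar>) ` {..<n}"
      using k by (intro Max_in) auto
    then obtain i where "i < n" "\<bar>v $ i\<bar> = Max ((\<lambda>j. \<bar>v $ j\<bar>) ` {..<n})" by auto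
    with that show thesis by simp
  qed
  have "a * v $ i = (\<Sum>j<n. A $$ (i, j) * v $ j)"
    using arg_cong[OF Av, of "\<lambda>w. w $ i"] i A v
    by (simp add: scalar_prod_def atLeast0LessThan)
  then have "a * (v $ i)\<^sup>2 = (\<Sum>j<n. A $$ (i, j) * (v $ j * v $ i))"
    by (simp add: power2_eq_square sum_distrib_right flip: mult.assoc)
  \<comment> \<open>The row sum is 0, so subtracting the constant \<open>(v $ i)\<^sup>2\<close>
    changes nothing. It kills the diagonal term, and off the diagonal both factors become
    nonpositive.\<close>
  also have "\<dots> = (\<Sum>j<n. A $$ (i, j) * (v $ j * v $ i - (v $ i)\<^sup>2))"
    using row[OF i] by (simp add: right_diff_distrib sum_subtractf flip: sum_distrib_right)
  also have "\<dots> \<ge> 0"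
  proof (rule sum_nonneg)
    fix j assume "j \<in> {..<n}"
    then have j: "j < n" by simp
    have "v $ j * v $ i \<le> \<bar>v $ j\<bar> * \<bar>v $ i\<bar>" by (metis abs_ge_self abs_mult)
    also have "\<dots> \<le> \<bar>v $ i\<bar> * \<bar>v $ i\<bar>" using max[OF j] by (intro mult_right_mono) auto
    finally have "v $ j * v $ i - (v $ i)\<^sup>2 \<le> 0" by (simp add: power2_eq_square)
    then show "0 \<le> A $$ (i, j) * (v $ j * v $ i - (v $ i)\<^sup>2)"
      using off[OF i j] by (cases "i = j") (auto simp: power2_eq_square mult_nonpos_nonpos)
  qed
  finally have "0 \<le> a * (v $ i)\<^sup>2" .
  moreover have "0 < (v $ i)\<^sup>2" using max[OF k(1)] k(2) by auto
  ultimately show ?thesis by (simp add: zero_le_mult_iff)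
qed

lemma zero_laplacian_eigenvalue:
  assumes G: "pair_graph G" and vs: "vertex_enum G vs" and ne: "pverts G \<noteq> {}"
  shows "eigenvalue (laplacian_matrix vs G) 0"
proof -
  let ?v = "vec (length vs) (\<lambda>_. 1 :: real)"
  have "length vs > 0" using vs ne by (auto simp: vertex_enum_def)
  then have "?v \<noteq> 0\<^sub>v (length vs)" by (metis index_vec index_zero_vec(1) zero_neq_one)
  moreover have "laplacian_matrix vs G *\<^sub>v ?v = 0 \<cdot>\<^sub>v ?v"
    by (rule eq_vecI)
       (auto simp: scalar_prod_def atLeast0LessThan laplacian_row_sum[OF G vs])
  ultimately show ?thesis
    unfolding eigenvalue_def eigenvector_def by (intro exI[of _ ?v]) simp
qed

text \<open>The all-ones vector gives the eigenvalue 0 and no eigenvalue is negative, so the sorted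
  spectrum starts with \<open>\<mu>_1\<close> = 0.\<close>

lemma laplacian_spectrum_conv_eigenvalues:
  assumes G: "pair_graph G" and n: "card (pverts G) = n" "n \<ge> 1"
  shows "laplacian_spectrum G = add_mset 0 {# laplacian_eigenvalue G j. j \<in># mset_set {2..n} #}"
proof -
  interpret pair_graph G by fact
  obtain vs where vs: "vertex_enum G vs" using ex_vertex_enum pair_finite_verts by blast
  define xs where "xs = sorted_list_of_multiset (laplacian_spectrum G)"
  have set: "set xs = set_mset (laplacian_spectrum G)" and mset: "mset xs = laplacian_spectrum G"
    and sorted: "sorted xs"
    by (simp_all add: xs_def)
  have len: "length xs = n"
    using size_laplacian_spectrum[OF G] n mset by (metis size_mset)
  have "pverts G \<noteq> {}" using n by auto
  then have "0 \<in> set xs"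
    using zero_laplacian_eigenvalue[OF G vs] by (auto simp: set laplacian_eigenvalue_iff[OF vs])
  then obtain k where "k < length xs" "xs ! k = 0" by (auto simp: in_set_conv_nth)
  then have "xs ! 0 \<le> 0" using sorted_nth_mono[OF sorted, of 0 k] by simp
  moreover have "xs ! 0 \<in> set xs" using len n by simp
  then have "0 \<le> xs ! 0"
    unfolding set laplacian_eigenvalue_iff[OF vs]
    using laplacian_row_sum[OF G vs]
    by (rule eigenvalue_nonneg[OF laplacian_matrix_carrier, rotated 2])
       (auto simp: laplacian_matrix_index)
  ultimately have "xs ! 0 = 0" by simp
  \<comment> \<open>Lists count from 0 and eigenvalues from 1, hence the index \<open>j - 1\<close>
    with j starting at 2.\<close>
  then have "xs = 0 # map (\<lambda>j. xs ! (j - 1)) [2..<Suc n]"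
    using len n by (intro nth_equalityI) (auto simp: nth_Cons simp del: upt_Suc split: nat.split)
  then have "mset xs = add_mset 0 {# xs ! (j - 1). j \<in># mset_set {2..<Suc n} #}"
    by (metis mset.simps(2) mset_map mset_upt)
  then show ?thesis
    unfolding mset by (simp add: laplacian_eigenvalue_def xs_def atLeastLessThanSuc_atLeastAtMost)
qed

section \<open>The NNS join\<close>

lemma parcs_nns_join [simp]:
  "(Inl (Inl u), Inl (Inl v)) \<in> parcs (nns_join G H) \<longleftrightarrow> (u, v) \<in> parcs G"
  "(Inl (Inr w), Inl (Inr z)) \<in> parcs (nns_join G H) \<longleftrightarrow> (w, z) \<in> parcs H"
  "(Inl (Inl u), Inl (Inr w)) \<in> parcs (nns_join G H) \<longleftrightarrow> u \<in> pverts G \<and> w \<in> pverts H"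
  "(Inl (Inr w), Inl (Inl u)) \<in> parcs (nns_join G H) \<longleftrightarrow> u \<in> pverts G \<and> w \<in> pverts H"
  "(Inr u, Inl (Inl v)) \<in> parcs (nns_join G H) \<longleftrightarrow>
    u \<in> pverts G \<and> v \<in> pverts G \<and> u \<noteq> v \<and> (u, v) \<notin> parcs G"
  "(Inl (Inl v), Inr u) \<in> parcs (nns_join G H) \<longleftrightarrow>
    u \<in> pverts G \<and> v \<in> pverts G \<and> u \<noteq> v \<and> (u, v) \<notin> parcs G"
  "(Inr u, Inr v) \<notin> parcs (nns_join G H)"
  "(Inr u, Inl (Inr w)) \<notin> parcs (nns_join G H)"
  "(Inl (Inr w), Inr u) \<notin> parcs (nns_join G H)"
  by (auto simp: nns_join_def graph_join_def)

text \<open>What remains outside the closed neighbourhood, which has r + 1 elements. The count is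
  taken in the reals to avoid truncated subtraction.\<close>

lemma card_nonneighbors:
  assumes G: "regular_graph r G" and u: "u \<in> pverts G"
  shows "real (card {v \<in> pverts G. u \<noteq> v \<and> (u, v) \<notin> parcs G}) = real (card (pverts G)) - 1 - real r"
proof -
  interpret pair_graph G using G by (simp add: regular_graph_def)
  let ?N = "insert u {v. (u, v) \<in> parcs G}"
  have sub: "?N \<subseteq> pverts G" using u in_arcsD2 by blast
  have fin: "finite ?N" by (rule finite_subset[OF sub pair_finite_verts])
  have "(u, u) \<notin> parcs G" using pair_no_loops by fastforce
  then have card: "card ?N = r + 1"
    using G u fin by (simp add: regular_graph_def out_degree_with_proj)
  have "{v \<in> pverts G. u \<noteq> v \<and> (u, v) \<notin> parcs G} = pverts G - ?N" by auto
  then have "real (card {v \<in> pverts G. u \<noteq> v \<and> (u, v) \<notin> parcs G}) = real (card (pverts G)) - card ?N"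
    using card_Diff_subset[OF fin sub] card_mono[OF pair_finite_verts sub] by simp
  then show ?thesis using card by simp
qed

text \<open>A vertex u_i has r neighbours in G, all of H, and one new neighbour per nonneighbour. As
  the last number is card V(G) - 1 - r, the r cancels.\<close>

lemma out_degree_nns_join:
  assumes G: "regular_graph r G" and H: "regular_graph r' H"
  shows "u \<in> pverts G \<Longrightarrow> real (out_degree (with_proj (nns_join G H)) (Inl (Inl u)))
      = real (card (pverts G)) + real (card (pverts H)) - 1"
    and "u \<in> pverts G \<Longrightarrow> real (out_degree (with_proj (nns_join G H)) (Inr u))
      = real (card (pverts G)) - 1 - real r"
    and "w \<in> pverts H \<Longrightarrow> real (out_degree (with_proj (nns_join G H)) (Inl (Inr w)))
      = real r' + real (card (pverts G))"
proof -
  interpret G: pair_graph G using G by (simp add: regular_graph_def)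
  interpret H: pair_graph H using H by (simp add: regular_graph_def)
  let ?N = "\<lambda>x. {y. (x, y) \<in> parcs (nns_join G H)}"
  let ?non = "\<lambda>u. {v \<in> pverts G. u \<noteq> v \<and> (u, v) \<notin> parcs G}"
  have finG: "finite {v. (u, v) \<in> parcs G}" for u
    by (rule finite_subset[OF _ G.pair_finite_verts]) (use G.in_arcsD2 in blast)
  have finH: "finite {v. (w, v) \<in> parcs H}" for w
    by (rule finite_subset[OF _ H.pair_finite_verts]) (use H.in_arcsD2 in blast)
  have fin_non: "finite (?non u)" for u using G.pair_finite_verts by simp
  show "real (out_degree (with_proj (nns_join G H)) (Inl (Inl u)))
      = real (card (pverts G)) + real (card (pverts H)) - 1" if u: "u \<in> pverts G"
  proof -
    \<comment> \<open>The arc from v to u' is governed by the pair (u, v); symmetry of G turns the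
      new neighbours of u into copies of its nonneighbours.\<close>
    have "?N (Inl (Inl u)) = (Inl \<circ> Inl) ` {v. (u, v) \<in> parcs G}
      \<union> ((Inl \<circ> Inr) ` pverts H \<union> Inr ` ?non u)"
      using u G.arcs_symmetric by (auto simp: nns_join_def graph_join_def)
    then have "card (?N (Inl (Inl u))) = card {v. (u, v) \<in> parcs G} + (card (pverts H) + card (?non u))"
      using finG fin_non H.pair_finite_verts
      by (simp only:, subst card_Un_disjoint; (subst card_Un_disjoint)?)
         (auto simp: card_image inj_on_def)
    then show ?thesis
      using G u card_nonneighbors[OF G u]
      by (simp add: out_degree_with_proj regular_graph_def)
  qed
  show "real (out_degree (with_proj (nns_join G H)) (Inr u))
      = real (card (pverts G)) - 1 - real r" if u: "u \<in> pverts G"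
  proof -
    have "?N (Inr u) = (Inl \<circ> Inl) ` ?non u"
      using u by (auto simp: nns_join_def graph_join_def)
    then show ?thesis
      using card_nonneighbors[OF G u] by (simp add: out_degree_with_proj card_image inj_on_def)
  qed
  show "real (out_degree (with_proj (nns_join G H)) (Inl (Inr w)))
      = real r' + real (card (pverts G))" if w: "w \<in> pverts H"
  proof -
    have "?N (Inl (Inr w)) = (Inl \<circ> Inr) ` {z. (w, z) \<in> parcs H} \<union> (Inl \<circ> Inl) ` pverts G"
      using w by (auto simp: nns_join_def graph_join_def)
    then have "card (?N (Inl (Inr w))) = card {z. (w, z) \<in> parcs H} + card (pverts G)"
      using finH G.pair_finite_verts
      by (simp only:, subst card_Un_disjoint) (auto simp: card_image inj_on_def)
    then show ?thesis
      using H w by (simp add: out_degree_with_proj regular_graph_def)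
  qed
qed

section \<open>The block form of the Laplacian of the NNS join\<close>

definition nns_enum :: "'a list \<Rightarrow> 'b list \<Rightarrow> (('a + 'b) + 'a) list" where
  "nns_enum vs ws = map (Inl \<circ> Inl) vs @ map Inr vs @ map (Inl \<circ> Inr) ws"

lemma vertex_enum_nns_join:
  assumes "vertex_enum G vs" "vertex_enum H ws"
  shows "vertex_enum (nns_join G H) (nns_enum vs ws)"
  using assms
  by (auto simp: vertex_enum_def nns_enum_def nns_join_def graph_join_def distinct_map inj_on_def)

lemma nth_nns_enum:
  "i < length vs \<Longrightarrow> nns_enum vs ws ! i = Inl (Inl (vs ! i))"
  "i < length vs \<Longrightarrow> nns_enum vs ws ! (length vs + i) = Inr (vs ! i)"
  "i < length ws \<Longrightarrow> nns_enum vs ws ! (length vs + length vs + i) = Inl (Inr (ws ! i))"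
  by (simp_all add: nns_enum_def nth_append)

lemma less_add_add_cases:
  assumes "(i :: nat) < n + n + m"
  obtains "i < n" | i' where "i = n + i'" "i' < n" | i' where "i = n + n + i'" "i' < m"
proof -
  consider "i < n" | "n \<le> i" "i < n + n" | "n + n \<le> i" by linarith
  then show thesis
    using that(1) that(2)[of "i - n"] that(3)[of "i - (n + n)"] assms by cases auto
qed

text \<open>Since L(G) = r I - A(G), the shift by s = r + 1 makes \<open>K\<close> equal to J - I -
  A(G), with ones exactly at distinct nonadjacent pairs. In the first block it replaces the degree r
  by n + m - 1, and for the u_i' it encodes the degree n - 1 - r.\<close>

lemma laplacian_nns_join_blocks:
  fixes G :: "'a pair_pre_digraph" and H :: "'b pair_pre_digraph" and x :: complex
  assumes G: "regular_graph r G" and H: "regular_graph r' H"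
    and vs: "vertex_enum G vs" and ws: "vertex_enum H ws"
    and n: "n = length vs" and m: "m = length ws"
  defines "s \<equiv> of_nat r + 1"
    and "L1 \<equiv> map_mat complex_of_real (laplacian_matrix vs G)"
    and "L2 \<equiv> map_mat complex_of_real (laplacian_matrix ws H)"
  defines "K \<equiv> const_mat n n 1 + (L1 - s \<cdot>\<^sub>m 1\<^sub>m n)"
  shows "x \<cdot>\<^sub>m 1\<^sub>m (n + n + m) - map_mat complex_of_real (laplacian_matrix (nns_enum vs ws) (nns_join G H))
   = four_block_mat
      (four_block_mat ((x - of_nat n - of_nat m + s) \<cdot>\<^sub>m 1\<^sub>m n - L1) K K ((x - of_nat n + s) \<cdot>\<^sub>m 1\<^sub>m n))
      (mat (n + n) m (\<lambda>(i, j). if i < n then 1 else 0))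
      (mat m (n + n) (\<lambda>(i, j). if j < n then 1 else 0))
      ((x - of_nat n) \<cdot>\<^sub>m 1\<^sub>m m - L2)"
    (is "?M = ?F")
proof -
  interpret G: pair_graph G using G by (simp add: regular_graph_def)
  have len: "length (nns_enum vs ws) = n + n + m" by (simp add: nns_enum_def n m)
  have cards: "card (pverts G) = n" "card (pverts H) = m"
    using length_vertex_enum[OF vs] length_vertex_enum[OF ws] n m by auto
  have nth [simp]: "i < n \<Longrightarrow> nns_enum vs ws ! i = Inl (Inl (vs ! i))"
    "i < n \<Longrightarrow> nns_enum vs ws ! (n + i) = Inr (vs ! i)"
    "i < m \<Longrightarrow> nns_enum vs ws ! (n + n + i) = Inl (Inr (ws ! i))" for i
    using nth_nns_enum n m by metis+
  have inV [simp]: "i < n \<Longrightarrow> vs ! i \<in> pverts G" "i < m \<Longrightarrow> ws ! i \<in> pverts H" for i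
    using vs ws n m by (auto simp: vertex_enum_def)
  have eq [simp]: "i < n \<Longrightarrow> j < n \<Longrightarrow> vs ! i = vs ! j \<longleftrightarrow> i = j" for i j
    using vs n by (auto simp: vertex_enum_def nth_eq_iff_index_eq)
  have deg [simp]: "v \<in> pverts G \<Longrightarrow> out_degree (with_proj G) v = r"
    "w \<in> pverts H \<Longrightarrow> out_degree (with_proj H) w = r'" for v w
    using G H by (auto simp: regular_graph_def)
  note degN [simp] = out_degree_nns_join[OF G H, unfolded cards]
  have loop [simp]: "(v, v) \<notin> parcs G" for v using G.pair_no_loops by fastforce
  have dims: "dim_row L1 = n" "dim_col L1 = n" "dim_row L2 = m" "dim_col L2 = m"
    "dim_row K = n" "dim_col K = n"
    by (simp_all add: L1_def L2_def K_def n m)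
  have sym: "(u, v) \<in> parcs G \<longleftrightarrow> (v, u) \<in> parcs G" for u v
    using G.arcs_symmetric by blast
  have M: "?M $$ (i, j) = (if i = j then x else 0) -
      of_real ((if i = j then real (out_degree (with_proj (nns_join G H)) (nns_enum vs ws ! i)) else 0)
        - (if (nns_enum vs ws ! i, nns_enum vs ws ! j) \<in> parcs (nns_join G H) then 1 else 0))"
    if "i < n + n + m" "j < n + n + m" for i j
    using that len by (simp add: laplacian_matrix_index)
  have L1: "L1 $$ (i, j) = (if i = j then of_nat r else 0) -
      (if (vs ! i, vs ! j) \<in> parcs G then 1 else 0)" if "i < n" "j < n" for i j
    using that inV[of i] by (simp add: L1_def n laplacian_matrix_index)
  have L2: "L2 $$ (i, j) = (if i = j then of_nat r' else 0) -
      (if (ws ! i, ws ! j) \<in> parcs H then 1 else 0)" if "i < m" "j < m" for i j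
    using that inV[of i] by (simp add: L2_def m laplacian_matrix_index)
  have K: "K $$ (i, j) = 1 + (L1 $$ (i, j) - (if i = j then s else 0))" if "i < n" "j < n" for i j
    using that dims by (simp add: K_def)
  show ?thesis
  proof (rule eq_matI)
    fix i j assume "i < dim_row ?F" "j < dim_col ?F"
    then have ij: "i < n + n + m" "j < n + n + m" using dims by auto
    show "?M $$ (i, j) = ?F $$ (i, j)"
      unfolding M[OF ij]
      \<comment> \<open>Entries are compared on nine pairs of blocks; \<open>sym\<close> serves the
        block from u_i to u_j', where the pair of vertices occurs reversed.\<close>
      using ij(1)
      by (cases i rule: less_add_add_cases; use ij(2) in \<open>cases j rule: less_add_add_cases\<close>)
         (auto simp: L1 L2 K dims s_def sym)
  qed (use dims len in auto)
qed

section \<open>Comparison of the characteristic polynomial with the asserted factors\<close>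

lemma sum_singleton_mset:
  "(\<Sum>i\<in>A. {#f i#}) = image_mset f (mset_set A)"
  by (induction A rule: infinite_finite_induct) auto

text \<open>A nonzero difference has only finitely many roots, but the ring is infinite. This allows
  leaving out the points where a divisor vanishes.\<close>

lemma poly_eqI_cofinite:
  fixes p q :: "'a :: {idom, ring_char_0} poly"
  assumes "finite X" and "\<And>x. x \<notin> X \<Longrightarrow> poly p x = poly q x"
  shows "p = q"
proof (rule ccontr)
  assume "p \<noteq> q"
  then have "finite {x. poly (p - q) x = 0}" by (intro poly_roots_finite) auto
  moreover have "UNIV = X \<union> {x. poly (p - q) x = 0}" using assms(2) by auto
  ultimately show False
    using assms(1) infinite_UNIV_char_0[where 'a = 'a] by (metis finite_Un)
qed

theorem theorem6p2:
  fixes G1 :: "'a pair_pre_digraph" and G2 :: "'b pair_pre_digraph"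
    and r1 n1 r2 n2 :: nat
  assumes "regular_graph r1 G1" and "card (pverts G1) = n1" and "n1 \<ge> 1"
    and "regular_graph r2 G2" and "card (pverts G2) = n2" and "n2 \<ge> 1"
  shows "image_mset complex_of_real (laplacian_spectrum (nns_join G1 G2)) =
      {# complex_of_real (real n1 + laplacian_eigenvalue G2 j). j \<in># mset_set {2..n2} #}
    + (\<Sum>i\<in>{2..n1}. proots (map_poly complex_of_real
         [: real n1 ^ 2 - 2 * real r1 * real n1 - 2 * real n1 + real n1 * real n2
              - real r1 * real n2 - real n2
              + laplacian_eigenvalue G1 i * (real n1 + real r1 + 1 - laplacian_eigenvalue G1 i),
            2 * real r1 - 2 * real n1 - real n2 - laplacian_eigenvalue G1 i + 2,
            1 :]))
    + proots (map_poly complex_of_real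
         [: 0,
            real n1 * real n2 - real n2 * real r1 - real n2 + 2 * real n1 ^ 2
              - 2 * real r1 * real n1 - 2 * real n1,
            2 * real r1 - 3 * real n1 - real n2 + 2,
            1 :])"
    (is "?spec = ?lin + (\<Sum>i\<in>{2..n1}. proots (?q i)) + proots ?c")
proof -
  let ?N = "nns_join G1 G2"
  have G1: "pair_graph G1" and G2: "pair_graph G2"
    using assms by (auto simp: regular_graph_def)
  \<comment> \<open>An infinite set has \<open>card\<close> 0, so the positive cardinalities force
    finite vertex sets.\<close>
  obtain vs ws where vs: "vertex_enum G1 vs" and ws: "vertex_enum G2 ws"
    using ex_vertex_enum assms(3,6) unfolding assms(2,5)[symmetric]
    by (metis card.infinite not_one_le_zero)
  have len: "n1 = length vs" "n2 = length ws"
    using length_vertex_enum[OF vs] length_vertex_enum[OF ws] assms(2,5) by simp_all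
  define L1 where "L1 = map_mat complex_of_real (laplacian_matrix vs G1)"
  define L2 where "L2 = map_mat complex_of_real (laplacian_matrix ws G2)"
  define L where "L = map_mat complex_of_real (laplacian_matrix (nns_enum vs ws) ?N)"
  define s :: complex where "s = of_nat r1 + 1"
  have L1: "L1 \<in> carrier_mat n1 n1" and L2: "L2 \<in> carrier_mat n2 n2"
    and L: "L \<in> carrier_mat (n1 + n1 + n2) (n1 + n1 + n2)"
    by (auto simp: L1_def L2_def L_def len nns_enum_def)
  have pL: "char_poly L = (\<Prod>a\<in>#?spec. [:- a, 1:])"
    unfolding L_def
    by (rule char_poly_complex_laplacian[OF pair_graph_nns_join[OF G1 G2] vertex_enum_nns_join[OF vs ws]])
  define \<mu> where "\<mu> j = complex_of_real (laplacian_eigenvalue G1 j)" for j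
  define \<nu> where "\<nu> j = complex_of_real (laplacian_eigenvalue G2 j)" for j
  have S1: "char_poly L1 = (\<Prod>a\<in>#add_mset 0 (image_mset \<mu> (mset_set {2..n1})). [:- a, 1:])"
    using char_poly_complex_laplacian[OF G1 vs]
    unfolding L1_def \<mu>_def laplacian_spectrum_conv_eigenvalues[OF G1 assms(2,3)]
    by (simp add: image_mset.compositionality o_def)
  have S2: "char_poly L2 = (\<Prod>a\<in>#add_mset 0 (image_mset \<nu> (mset_set {2..n2})). [:- a, 1:])"
    using char_poly_complex_laplacian[OF G2 ws]
    unfolding L2_def \<nu>_def laplacian_spectrum_conv_eigenvalues[OF G2 assms(5,6)]
    by (simp add: image_mset.compositionality o_def)
  have row1: "(\<Sum>j<n1. L1 $$ (i, j)) = 0" if "i < n1" for i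
    using that laplacian_row_sum[OF G1 vs, of i] by (simp add: L1_def len flip: of_real_sum)
  have col1: "(\<Sum>i<n1. L1 $$ (i, j)) = 0" if "j < n1" for j
    using that laplacian_col_sum[OF G1 vs, of j] by (simp add: L1_def len flip: of_real_sum)
  have row2: "(\<Sum>j<n2. L2 $$ (i, j)) = 0" if "i < n2" for i
    using that laplacian_row_sum[OF G2 ws, of i] by (simp add: L2_def len flip: of_real_sum)
  define R where "R = (\<Prod>j\<in>{2..n2}. [:- (of_nat n1 + \<nu> j), 1:]) * (\<Prod>i\<in>{2..n1}. ?q i) * ?c"
  \<comment> \<open>\<open>b\<close> is \<open>\<beta>\<close> as a polynomial in x: the two
    divisors vanish only at n1 and at the roots of \<open>b\<close>.\<close>
  define b where
    "b = [:(s - of_nat n1) * (s - of_nat n1 - of_nat n2) - s\<^sup>2, 2 * s - 2 * of_nat n1 - of_nat n2, 1:]"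
  have "char_poly L = R"
  proof (rule poly_eqI_cofinite)
    show "finite ({of_nat n1} \<union> {x. poly b x = 0})"
      by (simp add: b_def poly_roots_finite del: poly_pCons)
  next
    fix x assume x: "x \<notin> {of_nat n1} \<union> {x. poly b x = 0}"
    define y where "y = x - of_nat n1"
    define d where "d = x - of_nat n1 + s"
    define \<beta> where "\<beta> = d * (x - of_nat n1 - of_nat n2 + s) - s\<^sup>2"
    have "poly b x = \<beta>"
      by (simp add: b_def \<beta>_def d_def algebra_simps power2_eq_square)
    with x have y: "y \<noteq> 0" and \<beta>: "\<beta> \<noteq> 0" by (auto simp: y_def)
    \<comment> \<open>The asserted quadratic in x is the quadratic in \<open>\<mu> i\<close> from
      the block determinant, regrouped.\<close>
    have q: "poly (?q i) x = \<beta> + (2 * s - d) * \<mu> i - (\<mu> i)\<^sup>2" for i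
      by (simp add: \<beta>_def d_def s_def \<mu>_def algebra_simps power2_eq_square)
    \<comment> \<open>The factors \<open>y\<close> and \<open>\<beta>\<close> from the two
      eigenvalues 0 cancel the denominators of the rank-one correction.\<close>
    have c: "poly ?c x = y * (\<beta> * (1 - (d * of_nat n2 / y + of_nat n1 - 2 * s) * of_nat n1 / \<beta>))"
    proof -
      have "y * (\<beta> * (1 - (d * of_nat n2 / y + of_nat n1 - 2 * s) * of_nat n1 / \<beta>))
        = y * \<beta> - (d * of_nat n2 + (of_nat n1 - 2 * s) * y) * of_nat n1"
        using y \<beta> by (simp add: field_simps)
      also have "\<dots> = poly ?c x"
        by (simp add: y_def \<beta>_def d_def s_def algebra_simps power2_eq_square)
      finally show ?thesis ..
    qed
    have "poly (char_poly L) x = det (x \<cdot>\<^sub>m 1\<^sub>m (n1 + n1 + n2) - L)"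
      by (rule poly_char_poly[OF L])
    also have "\<dots> = (\<Prod>a\<in>#add_mset 0 (image_mset \<nu> (mset_set {2..n2})). y - a)
      * (\<Prod>a\<in>#add_mset 0 (image_mset \<mu> (mset_set {2..n1})). \<beta> + (2 * s - d) * a - a\<^sup>2)
      * (1 - (d * of_nat n2 / y + of_nat n1 - 2 * s) * of_nat n1 / \<beta>)"
      unfolding L_def laplacian_nns_join_blocks[OF assms(1,4) vs ws len, folded s_def L1_def L2_def]
      unfolding y_def d_def \<beta>_def
      by (rule det_nns_join_blocks[OF L1 S1 row1 col1 L2 S2 row2])
         (use y \<beta> in \<open>simp_all add: y_def d_def \<beta>_def\<close>)
    \<comment> \<open>The entry 0 contributes \<open>y\<close> to the first product and
      \<open>\<beta>\<close> to the second; with the correction they form the cubic.\<close>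
    also have "\<dots> = (\<Prod>j\<in>{2..n2}. y - \<nu> j) * (\<Prod>i\<in>{2..n1}. poly (?q i) x) * poly ?c x"
      unfolding c q
      by (simp add: prod_unfold_prod_mset image_mset.compositionality o_def)
    also have "\<dots> = poly R x"
      unfolding R_def by (simp add: poly_prod y_def algebra_simps)
    finally show "poly (char_poly L) x = poly R x" .
  qed
  then have "?spec = proots R"
    using pL proots_prod_linear_factors by metis
  also have "\<dots> = (\<Sum>j\<in>{2..n2}. {#of_nat n1 + \<nu> j#}) + (\<Sum>i\<in>{2..n1}. proots (?q i)) + proots ?c"
  proof -
    have q: "?q i \<noteq> 0" for i by simp
    have c: "?c \<noteq> 0" by simp
    \<comment> \<open>Roots of a product of nonzero polynomials add up. Arbitrary factors
      \<open>f\<close>, \<open>g\<close>, \<open>h\<close> keep the concrete coefficients out of the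
      computation.\<close>
    have "proots ((\<Prod>j\<in>{2..n2}. [:- f j, 1:]) * (\<Prod>i\<in>{2..n1}. g i) * h)
      = (\<Sum>j\<in>{2..n2}. {#f j#}) + (\<Sum>i\<in>{2..n1}. proots (g i)) + proots h"
      if "\<And>i. g i \<noteq> 0" "h \<noteq> 0" for f :: "nat \<Rightarrow> complex" and g h
      using that by (simp add: proots_mult proots_prod)
    then show ?thesis
      unfolding R_def using q c .
  qed
  also have "(\<Sum>j\<in>{2..n2}. {#of_nat n1 + \<nu> j#}) = ?lin"
    by (simp add: sum_singleton_mset \<nu>_def)
  finally show ?thesis .
qed

end
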